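(* The set $\mathcal{B}_{1,2,4}$ consisting of the identities (M1) $(xy)(zt)=(xz)(yt)$, (M2) $(xy)(zt)=(ty)(zx)$, (M3) $((xy)z)t=((xt)z)y$, (M4) $(x(yz))t=(x(tz))y$, (M5) $x((yz)t)=z((yx)t)$, (M6) $x(y(zt))=z(y(xt))$, and $x(x(yz))=(x(zy))x$ is an independent basis for $\Sigma_{1,2,4}$.
   Context: $\Sigma_{1,2,4}$ is the set of groupoid identities satisfied in the integers $\mathbb{Z}$ by each of the binary operations $x+y$, $x-y$ and $-x-y$. A basis is a set of identities whose equational consequences are exactly $\Sigma_{1,2,4}$; it is independent if no member is a consequence of the others. *)

theory Defs
  imports Main
begin

datatype gterm = Var nat | Mul gterm gterm

type_synonym identity = "gterm \<times> gterm"

fun eval :: "('a \<Rightarrow> 'a \<Rightarrow> 'a) \<Rightarrow> (nat \<Rightarrow> 'a) \<Rightarrow> gterm \<Rightarrow> 'a" where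
  "eval f v (Var n) = v n"
| "eval f v (Mul s t) = f (eval f v s) (eval f v t)"

fun subst :: "(nat \<Rightarrow> gterm) \<Rightarrow> gterm \<Rightarrow> gterm" where
  "subst \<sigma> (Var n) = \<sigma> n"
| "subst \<sigma> (Mul s t) = Mul (subst \<sigma> s) (subst \<sigma> t)"

definition satisfies :: "('a \<Rightarrow> 'a \<Rightarrow> 'a) \<Rightarrow> identity \<Rightarrow> bool" where
  "satisfies f e \<longleftrightarrow> (\<forall>v. eval f v (fst e) = eval f v (snd e))"

text \<open>Equational consequence (Birkhoff's deductive system).\<close>
inductive derivable :: "identity set \<Rightarrow> gterm \<Rightarrow> gterm \<Rightarrow> bool" for E where
  ax: "(s, t) \<in> E \<Longrightarrow> derivable E s t"
| refl: "derivable E t t"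
| sym: "derivable E s t \<Longrightarrow> derivable E t s"
| trans: "derivable E s t \<Longrightarrow> derivable E t u \<Longrightarrow> derivable E s u"
| substI: "derivable E s t \<Longrightarrow> derivable E (subst \<sigma> s) (subst \<sigma> t)"
| cong: "derivable E s1 t1 \<Longrightarrow> derivable E s2 t2 \<Longrightarrow> derivable E (Mul s1 s2) (Mul t1 t2)"

definition consequences :: "identity set \<Rightarrow> identity set" where
  "consequences E = {(s, t). derivable E s t}"

definition Sigma124 :: "identity set" where
  "Sigma124 = {e. satisfies (\<lambda>x y. x + y :: int) e \<and> satisfies (\<lambda>x y. x - y :: int) e
                  \<and> satisfies (\<lambda>x y. - x - y :: int) e}"

definition is_basis :: "identity set \<Rightarrow> identity set \<Rightarrow> bool" where
  "is_basis B \<Sigma> \<longleftrightarrow> consequences B = \<Sigma>"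

definition independent :: "identity set \<Rightarrow> bool" where
  "independent B \<longleftrightarrow> (\<forall>e\<in>B. e \<notin> consequences (B - {e}))"

abbreviation "vx \<equiv> Var 0"
abbreviation "vy \<equiv> Var 1"
abbreviation "vz \<equiv> Var 2"
abbreviation "vt \<equiv> Var 3"

definition B124 :: "identity set" where
  "B124 = {
     (Mul (Mul vx vy) (Mul vz vt), Mul (Mul vx vz) (Mul vy vt)),
     (Mul (Mul vx vy) (Mul vz vt), Mul (Mul vt vy) (Mul vz vx)),
     (Mul (Mul (Mul vx vy) vz) vt, Mul (Mul (Mul vx vt) vz) vy),
     (Mul (Mul vx (Mul vy vz)) vt, Mul (Mul vx (Mul vt vz)) vy),
     (Mul vx (Mul (Mul vy vz) vt), Mul vz (Mul (Mul vy vx) vt)),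
     (Mul vx (Mul vy (Mul vz vt)), Mul vz (Mul vy (Mul vx vt))),
     (Mul vx (Mul vx (Mul vy vz)), Mul (Mul vx (Mul vz vy)) vx)}"

end

theory Submission
  imports Defs "HOL-Library.Multiset"
begin

text \<open>Give each leaf of a term the class in \<open>\<int>\<^sub>2 \<times>
  \<int>\<^sub>2\<close> formed by the parities of the numbers of left and right steps leading to
  it. By (M1)--(M6), subterms at disjoint positions of equal class can be exchanged. The multiset
  of leaf classes determines how many inner nodes each class has, and conversely such counts are
  realized by a term as soon as they satisfy the obvious balance equations and the root is to be
  an inner node. Counting with these,
  an induction that contracts sibling leaves shows that terms with the same multiset of pairs
  (variable, class) are equivalent under (M1)--(M6). An identity of \<open>Sigma124\<close> leaves
  one degree of freedom per variable: writing \<open>\<alpha>\<close>, \<open>\<beta>\<close> for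
  a left and a right step, two occurrences of classes \<open>1\<close>, \<open>\<beta>\<close> may
  turn into occurrences of classes \<open>\<alpha>\<close>, \<open>\<alpha>\<beta>\<close>. This
  is exactly what the last identity, below called (M7), does at the root of a term, and the counts
  show that one of the two sides of the identity can always be moved towards the other.\<close>

section \<open>Soundness of derivations and instances of the seven identities\<close>

lemma eval_subst: "eval f v (subst \<sigma> t) = eval f (\<lambda>n. eval f v (\<sigma> n)) t"
  by (induction t) auto

lemma derivable_sound:
  assumes "derivable E s t" "\<And>e. e \<in> E \<Longrightarrow> satisfies f e"
  shows "eval f v s = eval f v t"
  using assms(1)
proof (induction arbitrary: v rule: derivable.induct)
  case (ax s t)
  then show ?case using assms(2)[OF ax] by (simp add: satisfies_def)
qed (auto simp: eval_subst)

abbreviation equ :: "gterm \<Rightarrow> gterm \<Rightarrow> bool" (infix "\<approx>" 50) where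
  "s \<approx> t \<equiv> derivable B124 s t"

lemmas [intro] = derivable.refl
lemmas [trans] = derivable.trans

lemma B124_instance:
  assumes "(s, t) \<in> B124"
  shows "subst \<sigma> s \<approx> subst \<sigma> t"
  using assms by (intro derivable.substI derivable.ax)

definition assign :: "gterm \<Rightarrow> gterm \<Rightarrow> gterm \<Rightarrow> gterm \<Rightarrow> nat \<Rightarrow> gterm" where
  "assign x y z t n = (if n = 0 then x else if n = 1 then y else if n = 2 then z else t)"

lemma M1: "Mul (Mul x y) (Mul z t) \<approx> Mul (Mul x z) (Mul y t)"
  and M2: "Mul (Mul x y) (Mul z t) \<approx> Mul (Mul t y) (Mul z x)"
  and M3: "Mul (Mul (Mul x y) z) t \<approx> Mul (Mul (Mul x t) z) y"
  and M4: "Mul (Mul x (Mul y z)) t \<approx> Mul (Mul x (Mul t z)) y"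
  and M5: "Mul x (Mul (Mul y z) t) \<approx> Mul z (Mul (Mul y x) t)"
  and M6: "Mul x (Mul y (Mul z t)) \<approx> Mul z (Mul y (Mul x t))"
  and M7: "Mul x (Mul x (Mul y z)) \<approx> Mul (Mul x (Mul z y)) x"
proof -
  let ?\<sigma> = "assign x y z t"
  note inst = B124_instance[where \<sigma> = ?\<sigma>]
  show "Mul (Mul x y) (Mul z t) \<approx> Mul (Mul x z) (Mul y t)"
    using inst[of "Mul (Mul vx vy) (Mul vz vt)" "Mul (Mul vx vz) (Mul vy vt)"]
    by (simp add: assign_def B124_def)
  show "Mul (Mul x y) (Mul z t) \<approx> Mul (Mul t y) (Mul z x)"
    using inst[of "Mul (Mul vx vy) (Mul vz vt)" "Mul (Mul vt vy) (Mul vz vx)"]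
    by (simp add: assign_def B124_def)
  show "Mul (Mul (Mul x y) z) t \<approx> Mul (Mul (Mul x t) z) y"
    using inst[of "Mul (Mul (Mul vx vy) vz) vt" "Mul (Mul (Mul vx vt) vz) vy"]
    by (simp add: assign_def B124_def)
  show "Mul (Mul x (Mul y z)) t \<approx> Mul (Mul x (Mul t z)) y"
    using inst[of "Mul (Mul vx (Mul vy vz)) vt" "Mul (Mul vx (Mul vt vz)) vy"]
    by (simp add: assign_def B124_def)
  show "Mul x (Mul (Mul y z) t) \<approx> Mul z (Mul (Mul y x) t)"
    using inst[of "Mul vx (Mul (Mul vy vz) vt)" "Mul vz (Mul (Mul vy vx) vt)"]
    by (simp add: assign_def B124_def)
  show "Mul x (Mul y (Mul z t)) \<approx> Mul z (Mul y (Mul x t))"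
    using inst[of "Mul vx (Mul vy (Mul vz vt))" "Mul vz (Mul vy (Mul vx vt))"]
    by (simp add: assign_def B124_def)
  show "Mul x (Mul x (Mul y z)) \<approx> Mul (Mul x (Mul z y)) x"
    using inst[of "Mul vx (Mul vx (Mul vy vz))" "Mul (Mul vx (Mul vz vy)) vx"]
    by (simp add: assign_def B124_def)
qed

section \<open>Contexts and exchange of subterms\<close>

text \<open>The class of a position is the pair of parities of the numbers of left and right steps
  leading to it. In a frame, \<open>True\<close> means that the hole is the left factor; the frames of a
  context are listed from the hole outwards.\<close>

type_synonym parities = "bool \<times> bool"
type_synonym frame = "bool \<times> gterm"

fun step :: "bool \<Rightarrow> parities \<Rightarrow> parities" where
  "step True (l, r) = (\<not> l, r)"
| "step False (l, r) = (l, \<not> r)"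

fun app :: "frame \<Rightarrow> gterm \<Rightarrow> gterm" where
  "app (True, u) t = Mul t u"
| "app (False, u) t = Mul u t"

fun plug :: "frame list \<Rightarrow> gterm \<Rightarrow> gterm" where
  "plug [] t = t"
| "plug (f # c) t = plug c (app f t)"

fun pos :: "parities \<Rightarrow> frame list \<Rightarrow> parities" where
  "pos g [] = g"
| "pos g (f # c) = step (fst f) (pos g c)"

lemma step_cancel [simp]: "step a (step a g) = g"
  by (cases g; cases a) auto

lemma step_eq_iff [simp]: "step a g = step a h \<longleftrightarrow> g = h"
  by (metis step_cancel)

lemma app_flip: "app (a, u) t = app (\<not> a, t) u"
  by (cases a) auto

lemma plug_append: "plug (c @ d) t = plug d (plug c t)"
  by (induction c arbitrary: t) auto

lemma pos_append: "pos g (c @ d) = pos (pos g d) c"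
  by (induction c) auto

lemma app_cong: "s \<approx> t \<Longrightarrow> app f s \<approx> app f t"
  by (cases f; cases "fst f") (auto intro: derivable.cong)

lemma plug_cong: "s \<approx> t \<Longrightarrow> plug c s \<approx> plug c t"
  by (induction c arbitrary: s t) (auto intro: app_cong)

text \<open>Each choice of \<open>a\<close> and \<open>p\<close> is one of (M3)--(M6). One left and
  one right step together turn side \<open>a\<close> into the opposite side, so \<open>x\<close> has
  the class of \<open>z\<close>.\<close>

lemma exchange_3_1:
  "p \<noteq> q \<Longrightarrow> app (a, z) (app (q, u) (app (p, w) x)) \<approx> app (a, x) (app (q, u) (app (p, w) z))"
  by (cases a; cases p; cases q) (auto intro: M3 M4 M5 M6)

text \<open>(M1) exchanges the inner two, (M2) the outer two grandchildren of a product.\<close>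

lemma exchange_2_2:
  "p \<noteq> q \<Longrightarrow> app (a, app (q, u) y) (app (p, w) x) \<approx> app (a, app (q, u) x) (app (p, w) y)"
  by (cases a; cases p; cases q) (auto intro: M1 M2)

text \<open>The two holes lie in different factors of one product: \<open>c\<close> leads into the
  factor on side \<open>a\<close>, \<open>d\<close> into the other. In \<open>same_class\<close>,
  \<open>g\<close> is the class of that product.\<close>

definition exchangeable :: "bool \<Rightarrow> frame list \<Rightarrow> frame list \<Rightarrow> bool" where
  "exchangeable a c d \<longleftrightarrow>
     (\<forall>x y. app (a, plug d y) (plug c x) \<approx> app (a, plug d x) (plug c y))"

definition same_class :: "parities \<Rightarrow> bool \<Rightarrow> frame list \<Rightarrow> frame list \<Rightarrow> bool" where
  "same_class g a c d \<longleftrightarrow> pos (step a g) c = pos (step (\<not> a) g) d"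

text \<open>The induction hypothesis of \<open>exchange\<close>, measured by the total length of
  both contexts.\<close>

definition exchange_below :: "parities \<Rightarrow> nat \<Rightarrow> bool" where
  "exchange_below g n \<longleftrightarrow>
     (\<forall>a c d. length c + length d < n \<longrightarrow> same_class g a c d \<longrightarrow> exchangeable a c d)"

lemma exchangeableD:
  "exchangeable a c d \<Longrightarrow> app (a, plug d y) (plug c x) \<approx> app (a, plug d x) (plug c y)"
  by (simp add: exchangeable_def)

lemma exchange_belowD:
  assumes "exchange_below g n" "same_class g a c d" "length c + length d < n"
  shows "app (a, plug d y) (plug c x) \<approx> app (a, plug d x) (plug c y)"
  using assms by (auto simp: exchangeable_def exchange_below_def)

lemma exchangeable_flip: "exchangeable (\<not> a) d c \<Longrightarrow> exchangeable a c d"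
  unfolding exchangeable_def by (metis app_flip)

lemma same_class_flip: "same_class g (\<not> a) d c \<longleftrightarrow> same_class g a c d"
  by (auto simp: same_class_def)

text \<open>Conjugation with the sibling \<open>z\<close> of the grandparent of \<open>x\<close>, which lies in the class
  of \<open>x\<close> and is closer to both \<open>x\<close> and \<open>y\<close>.\<close>

lemma exchange_via_uncle:
  assumes below: "exchange_below g (length c + length d)"
    and c: "c = (p, w) # (q, u) # (b, z) # c0" and "p \<noteq> q"
    and cls: "same_class g a c d"
  shows "exchangeable a c d"
  unfolding exchangeable_def
proof (intro allI)
  fix x y
  let ?D = "\<lambda>x z y. app (a, plug d y) (plug c0 (app (b, z) (app (q, u) (app (p, w) x))))"
  have near: "?D x z y \<approx> ?D z x y" for x y z
    by (intro app_cong plug_cong exchange_3_1 \<open>p \<noteq> q\<close>)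
  have far: "?D x z y \<approx> ?D x y z" for x y z
  proof -
    let ?c = "(\<not> b, app (q, u) (app (p, w) x)) # c0"
    have "same_class g a ?c d"
      using cls \<open>p \<noteq> q\<close> unfolding same_class_def c
      by (cases "pos (step a g) c0"; cases p; cases q; cases b) auto
    then have "app (a, plug d y) (plug ?c z) \<approx> app (a, plug d z) (plug ?c y)"
      by (rule exchange_belowD[OF below]) (simp add: c)
    then show ?thesis by (simp add: app_flip[of b])
  qed
  have "?D x z y \<approx> ?D z x y" by (rule near)
  also have "\<dots> \<approx> ?D z y x" by (rule far)
  also have "\<dots> \<approx> ?D y z x" by (rule near)
  finally show "app (a, plug d y) (plug c x) \<approx> app (a, plug d x) (plug c y)"
    by (simp add: c)
qed

text \<open>The uncle \<open>z\<close> of \<open>x\<close> has the class of the parent of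
  \<open>y\<close>. By hypothesis that parent can change places with \<open>z\<close>; then
  \<open>x\<close> and \<open>y\<close> are cousins and \<open>exchange_2_2\<close> applies, after
  which the parent moves back.\<close>

lemma exchange_unlike_parents:
  assumes below: "exchange_below g (length c + length d)"
    and c: "c = (p, w) # (b, z) # c0" and d: "d = (q, u) # d0" and "p \<noteq> q"
    and cls: "same_class g a c d"
  shows "exchangeable a c d"
  unfolding exchangeable_def
proof (intro allI)
  fix x y
  let ?D = "\<lambda>s t x. app (a, plug d0 t) (plug c0 (app (b, s) (app (p, w) x)))"
  have far: "?D s t x \<approx> ?D t s x" for s t x
  proof -
    let ?c = "(\<not> b, app (p, w) x) # c0"
    have "same_class g a ?c d0"
      using cls \<open>p \<noteq> q\<close> unfolding same_class_def c d
      by (cases "pos (step a g) c0"; cases "pos (step (\<not> a) g) d0"; cases p; cases q; cases b) auto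
    then have "app (a, plug d0 t) (plug ?c s) \<approx> app (a, plug d0 s) (plug ?c t)"
      by (rule exchange_belowD[OF below]) (simp add: c d)
    then show ?thesis by (simp add: app_flip[of b])
  qed
  have "?D z (app (q, u) y) x \<approx> ?D (app (q, u) y) z x" by (rule far)
  also have "\<dots> \<approx> ?D (app (q, u) x) z y"
    by (intro app_cong plug_cong exchange_2_2 \<open>p \<noteq> q\<close>)
  also have "\<dots> \<approx> ?D z (app (q, u) x) y" by (rule far)
  finally show "app (a, plug d y) (plug c x) \<approx> app (a, plug d x) (plug c y)"
    by (simp add: c d)
qed

text \<open>If the parents are alike, exchanging \<open>x\<close> and \<open>y\<close> amounts to exchanging the parents and
  then the siblings.\<close>

lemma exchange_via_siblings:
  assumes below: "exchange_below g (length c + length d)"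
    and c: "c = (p, w) # c0" and d: "d = (p, u) # d0"
    and siblings: "\<And>x y. exchangeable a ((\<not> p, x) # c0) ((\<not> p, y) # d0)"
    and cls: "same_class g a c d"
  shows "exchangeable a c d"
  unfolding exchangeable_def
proof (intro allI)
  fix x y
  have "same_class g a c0 d0"
    using cls by (simp add: same_class_def c d)
  then have "app (a, plug d0 (app (p, u) y)) (plug c0 (app (p, w) x))
      \<approx> app (a, plug d0 (app (p, w) x)) (plug c0 (app (p, u) y))"
    by (rule exchange_belowD[OF below]) (simp add: c d)
  also have "\<dots> \<approx> app (a, plug d0 (app (p, u) x)) (plug c0 (app (p, w) y))"
    using exchangeableD[OF siblings[of y x], of w u] by (simp add: app_flip[of "\<not> p"])
  finally show "app (a, plug d y) (plug c x) \<approx> app (a, plug d x) (plug c y)"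
    by (simp add: c d)
qed

text \<open>By \<open>exchange_3_1\<close> the factor containing \<open>y\<close> changes places
  with the sibling \<open>w\<close> of \<open>x\<close>. Now \<open>x\<close> stands directly beside
  that factor, and \<open>exchange_3_1\<close> applies to \<open>x\<close> and
  \<open>y\<close>.\<close>

lemma exchange_3_3:
  assumes "q \<noteq> p"
  shows "exchangeable a [(p, w), (p, u)] [(p, w'), (q, u')]"
  unfolding exchangeable_def
proof (intro allI)
  fix x y
  let ?V = "\<lambda>y. app (q, u') (app (p, w') y)"
  have outer: "app (a, V) (app (p, u) (app (p, w) x)) \<approx> app (a, w) (app (p, u) (app (\<not> p, x) V))" for V x
    using exchange_3_1[of "\<not> p" p a V u x w] by (simp add: app_flip[of p w])
  have inner: "app (\<not> p, x) (?V y) \<approx> app (\<not> p, y) (?V x)" for x y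
    using assms by (intro exchange_3_1) auto
  have "app (a, ?V y) (app (p, u) (app (p, w) x)) \<approx> app (a, w) (app (p, u) (app (\<not> p, x) (?V y)))"
    by (rule outer)
  also have "\<dots> \<approx> app (a, w) (app (p, u) (app (\<not> p, y) (?V x)))"
    by (intro app_cong inner)
  also have "\<dots> \<approx> app (a, ?V x) (app (p, u) (app (p, w) y))"
    by (rule derivable.sym[OF outer])
  finally show "app (a, plug [(p, w'), (q, u')] y) (plug [(p, w), (p, u)] x)
    \<approx> app (a, plug [(p, w'), (q, u')] x) (plug [(p, w), (p, u)] y)" by simp
qed

text \<open>Parents on unlike sides fall to \<open>exchange_unlike_parents\<close>. With like
  parents, three frames in \<open>c\<close> call for \<open>exchange_via_uncle\<close>, two for
  \<open>exchange_3_3\<close>; where the sides do not fit, those of the siblings of \<open>x\<close>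
  and \<open>y\<close> do.\<close>

lemma exchange_nonempty_aux:
  assumes below: "exchange_below g (length c + length d)"
    and len: "length c \<ge> length d" "d \<noteq> []"
    and cls: "same_class g a c d"
  shows "exchangeable a c d"
proof -
  obtain q u d0 where d: "d = (q, u) # d0" using len by (cases d) auto
  obtain p w c0 where c: "c = (p, w) # c0" using len d by (cases c) auto
  show ?thesis
  proof (cases c0)
    case Nil
    then have "d0 = []" using len c d by simp
    moreover have "p \<noteq> q"
      using cls Nil \<open>d0 = []\<close> unfolding c d same_class_def
      by (cases g; cases a; cases p; cases q) auto
    ultimately show ?thesis
      using Nil by (auto simp: c d exchangeable_def intro: exchange_2_2)
  next
    case (Cons f c1)
    obtain b z where f: "f = (b, z)" by (cases f)
    show ?thesis
    proof (cases "p = q")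
      case False
      then show ?thesis
        using exchange_unlike_parents[OF below c[unfolded Cons f] d _ cls] by simp
    next
      case True
      show ?thesis
      proof (cases c1)
        case Nil: Nil
        show ?thesis
        proof (cases d0)
          case Nil
          \<comment> \<open>The holes have depths 3 and 2 below the product; depths of different
            parity never give equal classes.\<close>
          then have False
            using cls Nil \<open>c1 = []\<close> True Cons unfolding c d f same_class_def
            by (cases g; cases a; cases p; cases b) auto
          then show ?thesis ..
        next
          case (Cons f' d1)
          obtain b' z' where f': "f' = (b', z')" by (cases f')
          have d1: "d1 = []" using len c d \<open>c0 = f # c1\<close> Nil Cons by simp
          have "b' \<noteq> b"
            using cls Nil d1 True \<open>c0 = f # c1\<close> Cons unfolding c d f f' same_class_def
            by (cases g; cases a; cases p; cases b; cases b') auto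
          show ?thesis
          proof (cases "p = b")
            case True
            then show ?thesis
              using exchange_3_3[of b' p a w z u z'] \<open>b' \<noteq> b\<close> \<open>p = q\<close> \<open>c0 = f # c1\<close> Nil Cons d1
              by (simp add: c d f f')
          next
            case False
            then have "b = (\<not> p)" by auto
            then have "exchangeable a ((\<not> p, x) # c0) ((\<not> p, y) # d0)" for x y
              using exchange_3_3[of b' "\<not> p" a x z y z'] \<open>b' \<noteq> b\<close> \<open>c0 = f # c1\<close> Nil Cons d1
              by (simp add: f f')
            then show ?thesis
              by (rule exchange_via_siblings[OF below c d[folded \<open>p = q\<close>] _ cls])
          qed
        qed
      next
        case (Cons f2 c2)
        obtain b2 z2 where f2: "f2 = (b2, z2)" by (cases f2)
        show ?thesis
        proof (cases "p = b")
          case False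
          then show ?thesis
            using exchange_via_uncle[OF below c[unfolded \<open>c0 = f # c1\<close> Cons f f2] _ cls] by simp
        next
          case True
          have "exchangeable a ((\<not> p, x) # c0) ((\<not> p, y) # d0)" for x y
          proof (rule exchange_via_uncle)
            show "exchange_below g (length ((\<not> p, x) # c0) + length ((\<not> p, y) # d0))"
              using below by (simp add: c d)
            show "(\<not> p, x) # c0 = (\<not> p, x) # (b, z) # (b2, z2) # c2"
              using \<open>c0 = f # c1\<close> Cons f f2 by simp
            show "(\<not> p) \<noteq> b" using True by simp
            show "same_class g a ((\<not> p, x) # c0) ((\<not> p, y) # d0)"
              using cls \<open>p = q\<close> unfolding same_class_def c d
              by (cases "pos (step a g) c0"; cases "pos (step (\<not> a) g) d0"; cases p) auto
          qed
          then show ?thesis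
            by (rule exchange_via_siblings[OF below c d[folded \<open>p = q\<close>] _ cls])
        qed
      qed
    qed
  qed
qed

lemma exchange_nonempty:
  assumes "exchange_below g (length c + length d)" "c \<noteq> []" "d \<noteq> []" "same_class g a c d"
  shows "exchangeable a c d"
proof (cases "length c \<ge> length d")
  case True
  then show ?thesis using exchange_nonempty_aux assms by blast
next
  case False
  then have "exchangeable (\<not> a) d c"
    using assms by (intro exchange_nonempty_aux) (auto simp: add.commute same_class_flip)
  then show ?thesis by (rule exchangeable_flip)
qed

text \<open>Here \<open>y\<close> is a whole factor of the product. If the last two steps to
  \<open>x\<close> differ, \<open>exchange_via_uncle\<close> applies, or \<open>exchange_3_1\<close>
  when \<open>y\<close> itself is the uncle. If they agree, they cancel, and the subterm two levels
  above \<open>x\<close> can change places with \<open>y\<close>.\<close>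

lemma exchange_empty:
  assumes below: "exchange_below g (length c)" and cls: "same_class g a c []"
  shows "exchangeable a c []"
proof -
  have "c \<noteq> []"
    using cls by (cases g; cases a) (auto simp: same_class_def)
  then obtain p w c' where c': "c = (p, w) # c'" by (cases c) auto
  have "c' \<noteq> []"
    using cls by (cases g; cases a; cases p) (auto simp: same_class_def c')
  then have "\<exists>p w q u c0. c = (p, w) # (q, u) # c0" using c' by (cases c') auto
  then obtain p w q u c0 where c: "c = (p, w) # (q, u) # c0" by blast
  show ?thesis
  proof (cases "p = q")
    case False
    show ?thesis
    proof (cases c0)
      case Nil
      then show ?thesis using exchange_3_1[OF False] by (simp add: exchangeable_def c)
    next
      case (Cons f c1)
      then show ?thesis
        using exchange_via_uncle[of g c "[]"] below cls c False by (cases f) auto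
    qed
  next
    case True
    then have cls0: "same_class g a c0 []" using cls by (simp add: same_class_def c)
    have "c0 \<noteq> []" using cls0 by (cases g; cases a) (auto simp: same_class_def)
    have far: "app (a, s) (plug c0 t) \<approx> app (a, t) (plug c0 s)" for s t
      using exchange_belowD[OF below cls0, of s t] by (simp add: c)
    have "same_class g a c0 [(p, w), (p, u)]"
      using cls0 by (simp add: same_class_def)
    \<comment> \<open>The total length is that of the goal, out of reach of the induction
      hypothesis; but now both contexts are nonempty.\<close>
    then have "exchangeable a c0 [(p, w), (p, u)]"
      using below \<open>c0 \<noteq> []\<close> by (intro exchange_nonempty) (auto simp: c)
    note mid = exchangeableD[OF this]
    show ?thesis
      unfolding exchangeable_def
    proof (intro allI)
      fix x y
      let ?P = "\<lambda>x. plug [(p, w), (p, u)] x"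
      have "app (a, y) (plug c0 (?P x)) \<approx> app (a, ?P x) (plug c0 y)" by (rule far)
      also have "\<dots> \<approx> app (a, ?P y) (plug c0 x)" by (rule mid)
      also have "\<dots> \<approx> app (a, x) (plug c0 (?P y))" by (rule far)
      finally show "app (a, plug [] y) (plug c x) \<approx> app (a, plug [] x) (plug c y)"
        by (simp add: c True)
    qed
  qed
qed

lemma exchange:
  assumes "same_class g a c d"
  shows "exchangeable a c d"
  using assms
proof (induction "length c + length d" arbitrary: a c d rule: less_induct)
  case less
  then have below: "exchange_below g (length c + length d)"
    by (auto simp: exchange_below_def)
  consider "d = []" | "c = []" | "c \<noteq> []" "d \<noteq> []" by blast
  then show ?case
  proof cases
    case 1
    then show ?thesis using exchange_empty below less.prems by simp
  next
    case 2
    then have "exchangeable (\<not> a) d []"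
      using below less.prems by (intro exchange_empty) (auto simp: same_class_flip)
    then show ?thesis using 2 exchangeable_flip by blast
  next
    case 3
    then show ?thesis using exchange_nonempty below less.prems by blast
  qed
qed

section \<open>Leaf multisets\<close>

abbreviation root :: parities where
  "root \<equiv> (False, False)"

fun leaves :: "parities \<Rightarrow> gterm \<Rightarrow> (nat \<times> parities) multiset" where
  "leaves g (Var x) = {#(x, g)#}"
| "leaves g (Mul s t) = leaves (step True g) s + leaves (step False g) t"

fun ctx_leaves :: "parities \<Rightarrow> frame list \<Rightarrow> (nat \<times> parities) multiset" where
  "ctx_leaves g [] = {#}"
| "ctx_leaves g (f # c) = ctx_leaves g c + leaves (step (\<not> fst f) (pos g c)) (snd f)"

lemma leaves_plug: "leaves g (plug c t) = ctx_leaves g c + leaves (pos g c) t"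
proof (induction c arbitrary: t)
  case (Cons f c)
  then show ?case by (cases f; cases "fst f") auto
qed simp

lemma leaf_position:
  "(p, h) \<in># leaves g t \<Longrightarrow> \<exists>c. t = plug c (Var p) \<and> pos g c = h"
proof (induction t arbitrary: g)
  case (Var x)
  then have "Var x = plug [] (Var p) \<and> pos g [] = h" by simp
  then show ?case by blast
next
  case (Mul s t)
  from Mul.prems consider "(p, h) \<in># leaves (step True g) s" | "(p, h) \<in># leaves (step False g) t"
    by auto
  then show ?case
  proof cases
    case 1
    then obtain c where "s = plug c (Var p)" "pos (step True g) c = h" using Mul.IH by blast
    then have "Mul s t = plug (c @ [(True, t)]) (Var p) \<and> pos g (c @ [(True, t)]) = h"
      by (simp add: plug_append pos_append)
    then show ?thesis by blast
  next
    case 2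
    then obtain c where "t = plug c (Var p)" "pos (step False g) c = h" using Mul.IH by blast
    then have "Mul s t = plug (c @ [(False, s)]) (Var p) \<and> pos g (c @ [(False, s)]) = h"
      by (simp add: plug_append pos_append)
    then show ?thesis by blast
  qed
qed

lemma leaves_subst:
  "leaves g (subst \<sigma> t) = (\<Sum>(x, h)\<in>#leaves g t. leaves h (\<sigma> x))"
  by (induction t arbitrary: g) auto

lemma subst_app: "subst \<sigma> (app f t) = app (fst f, subst \<sigma> (snd f)) (subst \<sigma> t)"
  by (cases f; cases "fst f") auto

lemma subst_plug: "subst \<sigma> (plug c t) = plug (map (apsnd (subst \<sigma>)) c) (subst \<sigma> t)"
  by (induction c arbitrary: t) (auto simp: subst_app apsnd_def map_prod_def split: prod.splits)

lemma pos_map_apsnd [simp]: "pos g (map (apsnd F) c) = pos g c"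
  by (induction c) auto

lemma subst_fresh: "v \<notin> fst ` set_mset (leaves g t) \<Longrightarrow> subst (Var(v := u)) t = t"
  by (induction t arbitrary: g) (auto simp: image_Un)

lemma subst_fresh_plug:
  "v \<notin> fst ` set_mset (ctx_leaves g c) \<Longrightarrow>
     subst (Var(v := u)) (plug c t) = plug c (subst (Var(v := u)) t)"
  by (induction c arbitrary: t) (auto simp: subst_app image_Un subst_fresh)

text \<open>Frames move from \<open>c\<close> to \<open>d\<close> during the induction until the
  sibling subterm containing the leaf \<open>p\<close> is met and \<open>exchange\<close> applies.
  The frames of \<open>d\<close> stay intact, which lets \<open>pair_exchange\<close> replace one
  leaf of a pair and keep the other.\<close>

lemma leaf_exchange:
  assumes "(p, pos g (d @ c)) \<in># ctx_leaves g c"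
  shows "\<exists>c'. pos g c' = pos g c \<and> plug c (plug d (Var x)) \<approx> plug c' (plug d (Var p)) \<and>
    add_mset (p, pos g (d @ c)) (ctx_leaves g c') = add_mset (x, pos g (d @ c)) (ctx_leaves g c)"
  using assms
proof (induction c arbitrary: d)
  case (Cons f c)
  obtain a u where f: "f = (a, u)" by (cases f)
  from Cons.prems consider
    "(p, pos g ((d @ [f]) @ c)) \<in># ctx_leaves g c" |
    "(p, pos g (d @ f # c)) \<in># leaves (step (\<not> a) (pos g c)) u"
    by (auto simp: f)
  then show ?case
  proof cases
    case 1
    from Cons.IH[OF this] obtain c' where "pos g c' = pos g c"
      "plug c (plug (d @ [f]) (Var x)) \<approx> plug c' (plug (d @ [f]) (Var p))"
      "add_mset (p, pos g ((d @ [f]) @ c)) (ctx_leaves g c')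
        = add_mset (x, pos g ((d @ [f]) @ c)) (ctx_leaves g c)"
      by blast
    then show ?thesis
      by (intro exI[of _ "f # c'"]) (auto simp: plug_append)
  next
    case 2
    then obtain e where e: "u = plug e (Var p)" "pos (step (\<not> a) (pos g c)) e = pos g (d @ f # c)"
      using leaf_position by blast
    then have "same_class (pos g c) a d e"
      by (simp add: same_class_def pos_append f)
    then have "app (a, plug e (Var p)) (plug d (Var x)) \<approx> app (a, plug e (Var x)) (plug d (Var p))"
      by (intro exchangeableD exchange)
    then have "plug (f # c) (plug d (Var x)) \<approx> plug ((a, plug e (Var x)) # c) (plug d (Var p))"
      by (simp add: f e plug_cong)
    then show ?thesis
      using e by (intro exI[of _ "(a, plug e (Var x)) # c"]) (auto simp: f leaves_plug)
  qed
qed simp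

lemma pair_exchange:
  assumes "(p, step a g) \<in># leaves root (plug c (app (a, Var w) (Var x)))" and pos: "pos root c = g"
  shows "\<exists>c'. pos root c' = g \<and> plug c (app (a, Var w) (Var x)) \<approx> plug c' (app (a, Var w) (Var p)) \<and>
    leaves root (plug c' (app (a, Var w) (Var p))) = leaves root (plug c (app (a, Var w) (Var x)))"
proof (cases "p = x")
  case False
  \<comment> \<open>The other leaf of the pair has a different class, so the occurrence of
    \<open>p\<close> lies outside the pair.\<close>
  have "step a g \<noteq> step (\<not> a) g" by (cases g; cases a) auto
  then have "(p, step a g) \<in># ctx_leaves root c"
    using assms False by (cases a) (auto simp: leaves_plug)
  then have "(p, pos root ([(a, Var w)] @ c)) \<in># ctx_leaves root c"
    using pos by simp
  from leaf_exchange[OF this, of x] obtain c' where c': "pos root c' = g"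
    "plug c (app (a, Var w) (Var x)) \<approx> plug c' (app (a, Var w) (Var p))"
    "add_mset (p, step a g) (ctx_leaves root c') = add_mset (x, step a g) (ctx_leaves root c)"
    using pos by auto
  then have "leaves root (plug c' (app (a, Var w) (Var p))) = leaves root (plug c (app (a, Var w) (Var x)))"
    using pos by (cases a) (auto simp: leaves_plug add_mset_commute)
  then show ?thesis using c' by blast
qed (use pos in auto)

section \<open>Class counts\<close>

fun inner :: "parities \<Rightarrow> gterm \<Rightarrow> parities \<Rightarrow> nat" where
  "inner g (Var x) h = 0"
| "inner g (Mul s t) h = of_bool (h = g) + inner (step True g) s h + inner (step False g) t h"

definition num :: "(nat \<times> parities) multiset \<Rightarrow> parities \<Rightarrow> nat" where
  "num m h = count (image_mset snd m) h"

lemma num_simps [simp]: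
  "num {#} h = 0"
  "num (add_mset (x, k) m) h = num m h + of_bool (k = h)"
  "num (m + m') h = num m h + num m' h"
  by (auto simp: num_def)

text \<open>Every node of class \<open>h\<close> is a leaf or an inner node, and it is the root or a child of an
  inner node whose class is one step away from \<open>h\<close>.\<close>

definition balanced :: "(parities \<Rightarrow> nat) \<Rightarrow> (nat \<times> parities) multiset \<Rightarrow> bool" where
  "balanced I m \<longleftrightarrow> (\<forall>h. num m h + I h = of_bool (h = root) + I (step True h) + I (step False h))"

lemma balance:
  "num (leaves g t) h + inner g t h =
     of_bool (h = g) + inner g t (step True h) + inner g t (step False h)"
proof (induction t arbitrary: g)
  case (Mul s t)
  have "(step a h = g) = (h = step a g)" for a by auto
  then show ?case using Mul.IH(1)[of "step True g"] Mul.IH(2)[of "step False g"] by simp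
qed (auto simp: num_def)

lemma balanced_leaves: "balanced (inner root t) (leaves root t)"
  by (simp add: balanced_def balance)

lemma all_parities:
  "(\<forall>h. P h) \<longleftrightarrow> P root \<and> P (True, False) \<and> P (False, True) \<and> P (True, True)"
  unfolding split_paired_All all_bool_eq by blast

lemma balanced_iff:
  "balanced I m \<longleftrightarrow>
     num m root + I root = 1 + I (True, False) + I (False, True) \<and>
     num m (True, False) + I (True, False) = I root + I (True, True) \<and>
     num m (False, True) + I (False, True) = I root + I (True, True) \<and>
     num m (True, True) + I (True, True) = I (True, False) + I (False, True)"
  unfolding balanced_def all_parities[of "\<lambda>h. num m h + I h = _ h"] by (simp add: ac_simps)

text \<open>In matrix form \<open>I\<close> is multiplied by the adjacency matrix of a 4-cycle minus
  the identity. The former has eigenvalues 2, 0, 0 and -2, so the difference is invertible.\<close>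

lemma balanced_unique:
  assumes "balanced I m" "balanced J m"
  shows "I = J"
proof -
  have "\<forall>h. I h = J h"
    using assms by (subst all_parities) (auto simp: balanced_iff)
  then show ?thesis by blast
qed

text \<open>In a term this is the contraction of a product of two leaves to a leaf \<open>v\<close>.
  Stated on counts, it is available before a term is known.\<close>

lemma balanced_contract:
  assumes "balanced I (add_mset (p, step True g) (add_mset (q, step False g) m))" "I g \<ge> 1"
  shows "balanced (I(g := I g - 1)) (add_mset (v, g) m)"
proof -
  obtain l r where g: "g = (l, r)" by (cases g)
  show ?thesis
    using assms unfolding g balanced_iff by (cases l; cases r; simp; arith)
qed

lemma pick:
  assumes "add_mset h N \<subseteq># image_mset snd m"
  shows "\<exists>p m'. m = add_mset (p, h) m' \<and> N \<subseteq># image_mset snd m'"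
proof -
  have "h \<in># image_mset snd m" using assms by (meson insert_subset_eq_iff)
  then obtain p where "(p, h) \<in># m" by force
  then obtain m' where "m = add_mset (p, h) m'" by (meson multi_member_split)
  then show ?thesis using assms by auto
qed

text \<open>As far as counts tell, a product of two leaves at class \<open>g\<close> can be
  contracted with the root remaining an inner node; hence the extra demand for
  \<open>g = root\<close>.\<close>

definition contractible :: "(parities \<Rightarrow> nat) \<Rightarrow> (nat \<times> parities) multiset \<Rightarrow> parities \<Rightarrow> bool" where
  "contractible I m g \<longleftrightarrow> I g \<ge> 1 \<and> (g = root \<longrightarrow> I root \<ge> 2) \<and>
     num m (step True g) \<ge> 1 \<and> num m (step False g) \<ge> 1"

text \<open>Leaves of classes \<open>(True, False)\<close> and \<open>(False, True)\<close> can be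
  the children at \<open>root\<close> or \<open>(True, True)\<close>. If one of these two classes
  has no leaves, balance forces inner nodes in it and leaves in the classes of their children. In
  the remaining case the root is the only inner node of even depth.\<close>

lemma contractible_exists:
  assumes "balanced I m" "I root \<ge> 1" "\<not> (I root = 1 \<and> (\<forall>h. h \<noteq> root \<longrightarrow> I h = 0))"
  shows "\<exists>g. contractible I m g"
proof -
  let ?A = "(True, False)" and ?B = "(False, True)" and ?C = "(True, True)"
  note bal = assms(1)[unfolded balanced_iff]
  consider "I root \<ge> 2 \<or> I ?C \<ge> 1" "num m ?A \<ge> 1" "num m ?B \<ge> 1"
    | "num m ?A = 0" "I root \<ge> 2 \<or> I ?C \<ge> 1"
    | "num m ?B = 0" "I root \<ge> 2 \<or> I ?C \<ge> 1"
    | "I root = 1" "I ?C = 0"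
    using assms(2) by linarith
  then show ?thesis
  proof cases
    case 1
    then have "contractible I m root \<or> contractible I m ?C"
      by (auto simp: contractible_def)
    then show ?thesis by blast
  next
    case 2
    then have "contractible I m ?A"
      using bal assms(2) unfolding contractible_def by simp
    then show ?thesis by blast
  next
    case 3
    then have "contractible I m ?B"
      using bal assms(2) unfolding contractible_def by simp
    then show ?thesis by blast
  next
    case 4
    then have "I ?A \<ge> 1 \<or> I ?B \<ge> 1"
      using assms(3) unfolding all_parities[of "\<lambda>h. h \<noteq> root \<longrightarrow> I h = 0"] by auto
    then have "contractible I m ?A \<or> contractible I m ?B"
      using 4 bal unfolding contractible_def by auto
    then show ?thesis by blast
  qed
qed

lemma pair_available:
  assumes "h \<noteq> k" "num m h \<ge> 1" "num m k \<ge> 1"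
  shows "{#h, k#} \<subseteq># image_mset snd m"
proof (rule mset_subset_eqI)
  show "count {#h, k#} a \<le> count (image_mset snd m) a" for a
    using assms unfolding num_def by (cases "a = h"; cases "a = k") auto
qed

lemma step_neq [simp]: "step True g \<noteq> step False g"
  by (cases g) auto

text \<open>Induction on the number of inner nodes: two leaves are contracted on the level of
  counts, the rest is realized, and the new leaf is expanded into a product again.\<close>

lemma realize:
  assumes "balanced I m" "I root \<ge> 1 \<or> (\<forall>h. I h = 0)"
  shows "\<exists>t. leaves root t = m"
  using assms
proof (induction "sum I UNIV" arbitrary: I m rule: less_induct)
  case less
  show ?case
  proof (cases "\<forall>h. I h = 0")
    case True
    then have zero: "I h = 0" for h by blast
    have "num m h = of_bool (h = root)" for h
      using spec[OF less.prems(1)[unfolded balanced_def], of h] by (simp add: zero)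
    then have "image_mset snd m = {#root#}"
      by (intro multiset_eqI) (auto simp: num_def)
    then obtain p where "m = {#(p, root)#}"
      using pick[of root "{#}" m] by auto
    then have "leaves root (Var p) = m" by simp
    then show ?thesis by blast
  next
    case False
    then have "I root \<ge> 1" using less.prems(2) by blast
    \<comment> \<open>The last alternative is a single product, whose contraction is a leaf with all
      counts zero.\<close>
    obtain g where g: "I g \<ge> 1" "num m (step True g) \<ge> 1" "num m (step False g) \<ge> 1"
      "g = root \<longrightarrow> I root \<ge> 2 \<or> (\<forall>h. h \<noteq> root \<longrightarrow> I h = 0)"
    proof (cases "I root = 1 \<and> (\<forall>h. h \<noteq> root \<longrightarrow> I h = 0)")
      case True
      then have "num m (True, False) \<ge> 1 \<and> num m (False, True) \<ge> 1"
        using less.prems(1) by (simp add: balanced_iff)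
      then show ?thesis using that[of root] True by simp
    next
      case False
      then obtain g where "contractible I m g"
        using contractible_exists[OF less.prems(1) \<open>I root \<ge> 1\<close>] by blast
      then show ?thesis
        using that[of g] unfolding contractible_def by blast
    qed
    then obtain p m1 where p: "m = add_mset (p, step True g) m1" "{#step False g#} \<subseteq># image_mset snd m1"
      using pick[OF pair_available[OF step_neq g(2,3)]] by blast
    then obtain q m2 where q: "m1 = add_mset (q, step False g) m2"
      using pick[OF p(2)] by blast
    let ?J = "I(g := I g - 1)"
    have "sum ?J UNIV < sum I UNIV"
      using g(1) by (intro sum_strict_mono_ex1 bexI[of _ g]) auto
    moreover have "balanced ?J (add_mset (0, g) m2)"
      using less.prems(1) g(1) unfolding p q by (rule balanced_contract)
    moreover have "?J root \<ge> 1 \<or> (\<forall>h. ?J h = 0)"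
    proof (cases "g = root \<and> I root = 1")
      case True
      then have "\<forall>h. h \<noteq> root \<longrightarrow> I h = 0" using g(4) by force
      then show ?thesis using True by (metis diff_self_eq_0 fun_upd_apply)
    next
      case False
      then have "?J root \<ge> 1" using \<open>I root \<ge> 1\<close> by (cases "g = root") auto
      then show ?thesis ..
    qed
    ultimately obtain t where t: "leaves root t = add_mset (0, g) m2"
      using less.hyps by blast
    \<comment> \<open>The placeholder \<open>0\<close> may also occur in \<open>m2\<close>;
      whichever leaf \<open>0\<close> of class \<open>g\<close> is expanded, the multiset becomes
      \<open>m\<close>.\<close>
    then obtain c where c: "t = plug c (Var 0)" "pos root c = g"
      using leaf_position[of 0 g root t] by auto
    then have "leaves root (plug c (Mul (Var p) (Var q))) = m"
      using t by (simp add: leaves_plug p q)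
    then show ?thesis by blast
  qed
qed

section \<open>Terms with equal leaf multisets\<close>

definition has_pair :: "parities \<Rightarrow> gterm \<Rightarrow> bool" where
  "has_pair g t \<longleftrightarrow> (\<exists>c x y. pos root c = g \<and> t = plug c (Mul (Var x) (Var y)))"

lemma pair_position: "\<exists>c x y. Mul s t = plug c (Mul (Var x) (Var y))"
proof (induction "Mul s t" arbitrary: s t)
  case (Mul s t)
  show ?case
  proof (cases s)
    case (Mul s1 s2)
    then obtain c x y where "s = plug c (Mul (Var x) (Var y))" using Mul.hyps(1) by blast
    then have "Mul s t = plug (c @ [(True, t)]) (Mul (Var x) (Var y))" by (simp add: plug_append)
    then show ?thesis by blast
  next
    case (Var x)
    show ?thesis
    proof (cases t)
      case (Mul t1 t2)
      then obtain c y z where "t = plug c (Mul (Var y) (Var z))" using Mul.hyps(2) by blast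
      then have "Mul s t = plug (c @ [(False, s)]) (Mul (Var y) (Var z))" by (simp add: plug_append)
      then show ?thesis by blast
    next
      case (Var y)
      then have "Mul s t = plug [] (Mul (Var x) (Var y))" using \<open>s = Var x\<close> by simp
      then show ?thesis by blast
    qed
  qed
qed

text \<open>Besides the inner nodes of \<open>t\<close> only the root is counted, which lies outside
  \<open>t\<close> when \<open>c\<close> is nonempty. This yields a second inner node of class
  \<open>root\<close> for a pair below the root at that class.\<close>

lemma inner_plug:
  "inner g (plug c t) h \<ge> inner (pos g c) t h + of_bool (c \<noteq> [] \<and> h = g)"
proof (induction c arbitrary: g rule: rev_induct)
  case (snoc f c)
  obtain a u where f: "f = (a, u)" by (cases f)
  show ?case
    using snoc.IH[of "step a g"] by (cases a) (auto simp: f plug_append pos_append)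
qed simp

definition unique_below :: "nat \<Rightarrow> bool" where
  "unique_below n \<longleftrightarrow>
     (\<forall>s t. size (leaves root s) < n \<longrightarrow> leaves root s = leaves root t \<longrightarrow> s \<approx> t)"

text \<open>Leaf exchanges give \<open>t\<close> the very pair that \<open>s\<close> has at class
  \<open>g\<close>. Contracting it to a fresh variable saves one leaf, so the hypothesis applies,
  and substitution restores the pair.\<close>

lemma equivalent_common_pair:
  assumes below: "unique_below (size (leaves root s))"
    and s: "has_pair g s" and t: "has_pair g t" and eq: "leaves root s = leaves root t"
  shows "s \<approx> t"
proof -
  obtain c x y where c: "pos root c = g" "s = plug c (Mul (Var x) (Var y))"
    using s by (auto simp: has_pair_def)
  obtain d x' y' where d: "pos root d = g" "t = plug d (Mul (Var x') (Var y'))"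
    using t by (auto simp: has_pair_def)
  have s_leaves: "(x, step True g) \<in># leaves root s" "(y, step False g) \<in># leaves root s"
    by (simp_all add: c leaves_plug)
  obtain d1 where d1: "pos root d1 = g" "t \<approx> plug d1 (Mul (Var x) (Var y'))"
    "leaves root (plug d1 (Mul (Var x) (Var y'))) = leaves root t"
    using pair_exchange[of x True g d y' x'] s_leaves eq d by auto
  obtain d2 where d2: "pos root d2 = g" "plug d1 (Mul (Var x) (Var y')) \<approx> plug d2 (Mul (Var x) (Var y))"
    "leaves root (plug d2 (Mul (Var x) (Var y))) = leaves root t"
    using pair_exchange[of y False g d1 x y'] s_leaves eq d1 by auto
  have ctx: "ctx_leaves root d2 = ctx_leaves root c"
  proof -
    have "leaves root (plug d2 (Mul (Var x) (Var y))) = leaves root s" using d2(3) eq by simp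
    then show ?thesis using d2(1) c by (simp add: leaves_plug)
  qed
  obtain v where v: "v \<notin> fst ` set_mset (ctx_leaves root c)"
    using ex_new_if_finite[of "fst ` set_mset (ctx_leaves root c)"] by auto
  have "plug c (Var v) \<approx> plug d2 (Var v)"
    using below c d2(1) ctx by (auto simp: unique_below_def leaves_plug)
  then have "subst (Var(v := Mul (Var x) (Var y))) (plug c (Var v))
      \<approx> subst (Var(v := Mul (Var x) (Var y))) (plug d2 (Var v))"
    by (rule derivable.substI)
  then have "s \<approx> plug d2 (Mul (Var x) (Var y))"
    using v ctx c subst_fresh_plug[of v root c] subst_fresh_plug[of v root d2] by simp
  also have "\<dots> \<approx> t"
    by (intro derivable.sym[OF derivable.trans[OF d1(2) d2(2)]])
  finally show ?thesis .
qed

section \<open>Two pairs of leaves available at once\<close>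

definition linked :: "(parities \<Rightarrow> nat) \<Rightarrow> (nat \<times> parities) multiset \<Rightarrow> parities \<Rightarrow> parities \<Rightarrow> bool" where
  "linked I m g h \<longleftrightarrow> g \<noteq> h \<and> contractible I m g \<and> contractible I m h \<and>
     {#step True g, step False g, step True h, step False h#} \<subseteq># image_mset snd m"

text \<open>Both pairs are contracted on counts, to distinct fresh variables, and the result is
  realized. Freshness makes the substitution expand exactly the two placeholders.\<close>

lemma linked_term:
  assumes bal: "balanced I m" and root: "I root \<ge> 1" and "linked I m g h"
  shows "\<exists>r. leaves root r = m \<and> has_pair g r \<and> has_pair h r"
proof -
  note l = assms(3)[unfolded linked_def contractible_def]
  obtain p m1 where p: "m = add_mset (p, step True g) m1"
      "{#step False g, step True h, step False h#} \<subseteq># image_mset snd m1"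
    using l pick by metis
  obtain q m2 where q: "m1 = add_mset (q, step False g) m2"
      "{#step True h, step False h#} \<subseteq># image_mset snd m2"
    using p(2) pick by metis
  obtain p' m3 where p': "m2 = add_mset (p', step True h) m3"
      "{#step False h#} \<subseteq># image_mset snd m3"
    using q(2) pick by metis
  obtain q' m4 where q': "m3 = add_mset (q', step False h) m4"
    using p'(2) pick by metis
  obtain v where v: "v \<notin> fst ` set_mset m4"
    using ex_new_if_finite[of "fst ` set_mset m4"] by auto
  obtain w where w: "w \<notin> insert v (fst ` set_mset m4)"
    using ex_new_if_finite[of "insert v (fst ` set_mset m4)"] by auto
  let ?J = "I(g := I g - 1)"
  let ?K = "?J(h := ?J h - 1)"
  have "balanced ?J (add_mset (v, g) m2)"
    using bal l unfolding p q by (intro balanced_contract) auto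
  then have "balanced ?K (add_mset (w, h) (add_mset (v, g) m4))"
    using l unfolding p' q' by (intro balanced_contract[of ?J p' h q']) (auto simp: add_mset_commute)
  \<comment> \<open>As \<open>g\<close> and \<open>h\<close> differ, at most one of them is
    \<open>root\<close>, and then \<open>I root\<close> is at least 2.\<close>
  moreover have "?K root \<ge> 1" using l root by auto
  ultimately obtain t where t: "leaves root t = add_mset (w, h) (add_mset (v, g) m4)"
    using realize by blast
  let ?\<sigma> = "Var(v := Mul (Var p) (Var q), w := Mul (Var p') (Var q'))"
  have "(\<Sum>(x, k)\<in>#m4. leaves k (?\<sigma> x)) = (\<Sum>x\<in>#m4. {#x#})"
  proof (intro arg_cong[where f = sum_mset] image_mset_cong)
    fix z assume "z \<in># m4"
    then have "fst z \<noteq> v" "fst z \<noteq> w" using v w by auto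
    then show "(case z of (x, k) \<Rightarrow> leaves k (?\<sigma> x)) = {#z#}" by (cases z) simp
  qed
  then have "leaves root (subst ?\<sigma> t) = m"
    using w by (auto simp: leaves_subst t p q p' q')
  moreover have "has_pair g (subst ?\<sigma> t)"
  proof -
    obtain c where "t = plug c (Var v)" "pos root c = g"
      using leaf_position[of v g root t] t by auto
    then show ?thesis
      unfolding has_pair_def using w
      by (intro exI[of _ "map (apsnd (subst ?\<sigma>)) c"] exI[of _ p] exI[of _ q]) (auto simp: subst_plug)
  qed
  moreover have "has_pair h (subst ?\<sigma> t)"
  proof -
    obtain c where "t = plug c (Var w)" "pos root c = h"
      using leaf_position[of w h root t] t by auto
    then show ?thesis
      unfolding has_pair_def
      by (intro exI[of _ "map (apsnd (subst ?\<sigma>)) c"] exI[of _ p'] exI[of _ q']) (auto simp: subst_plug)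
  qed
  ultimately show ?thesis by blast
qed

text \<open>Each step changes the parity of the depth, so the children at \<open>g\<close> and at
  \<open>h\<close> have four different classes.\<close>

lemma linked_opposite:
  assumes "contractible I m g" "contractible I m h" "(fst g = snd g) \<noteq> (fst h = snd h)"
  shows "linked I m g h"
proof -
  obtain l r where g: "g = (l, r)" by (cases g)
  obtain l' r' where h: "h = (l', r')" by (cases h)
  show ?thesis
    using assms unfolding linked_def g h contractible_def num_def
    by (cases l; cases r; cases l'; cases r') (auto simp: subseteq_mset_def)
qed

text \<open>Classes of equal depth parity have the same child classes, so two leaves of each are
  consumed.\<close>

lemma linked_alike:
  assumes "contractible I m g" "contractible I m h" "g \<noteq> h" "(fst g = snd g) = (fst h = snd h)"
    "num m (step True g) \<ge> 2" "num m (step False g) \<ge> 2"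
  shows "linked I m g h"
proof -
  obtain l r where g: "g = (l, r)" by (cases g)
  obtain l' r' where h: "h = (l', r')" by (cases h)
  show ?thesis
    using assms unfolding linked_def g h num_def
    by (cases l; cases r; cases l'; cases r') (auto simp: subseteq_mset_def)
qed

text \<open>Leaves can run short only if the child classes are shared. A child class with a single
  leaf is then contractible itself by balance and, by its depth parity, linked to both
  \<open>g\<close> and \<open>h\<close>.\<close>

lemma linked_exists:
  assumes bal: "balanced I m" and root: "I root \<ge> 1" and g: "contractible I m g" and h: "contractible I m h" and "g \<noteq> h"
  shows "linked I m g h \<or> (\<exists>k. linked I m g k \<and> linked I m k h)"
proof (cases "(fst g = snd g) = (fst h = snd h)")
  case alike: True
  note b = bal[unfolded balanced_iff]
  show ?thesis
  proof (cases "num m (step True g) \<ge> 2 \<and> num m (step False g) \<ge> 2")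
    case False
    have "\<exists>k. contractible I m k \<and> (fst k = snd k) \<noteq> (fst g = snd g)"
    proof (cases "fst g = snd g")
      case True
      have "g = root \<and> h = (True, True) \<or> g = (True, True) \<and> h = root"
        using True alike \<open>g \<noteq> h\<close> by (metis (full_types) prod.collapse)
      then have *: "contractible I m root" "contractible I m (True, True)"
        using g h by blast+
      have "num m (True, False) = 1 \<or> num m (False, True) = 1"
      proof -
        have "g = root \<or> g = (True, True)" using True by (metis (full_types) prod.collapse)
        then show ?thesis using False * by (auto simp: contractible_def)
      qed
      then have "contractible I m (True, False) \<or> contractible I m (False, True)"
        using * b unfolding contractible_def by auto
      then show ?thesis using True by (metis (full_types) fst_conv snd_conv)
    next
      case odd: False
      have "g = (True, False) \<and> h = (False, True) \<or> g = (False, True) \<and> h = (True, False)"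
        using odd alike \<open>g \<noteq> h\<close> by (metis (full_types) prod.collapse)
      then have *: "contractible I m (True, False)" "contractible I m (False, True)"
        using g h by blast+
      have "num m root = 1 \<or> num m (True, True) = 1"
      proof -
        have "g = (True, False) \<or> g = (False, True)" using odd by (metis (full_types) prod.collapse)
        then show ?thesis using False * by (auto simp: contractible_def)
      qed
      then have "contractible I m root \<or> contractible I m (True, True)"
      proof
        assume "num m root = 1"
        then have "contractible I m root"
          using * b unfolding contractible_def by auto
        then show ?thesis ..
      next
        assume "num m (True, True) = 1"
        then have "contractible I m (True, True)"
          using * b root unfolding contractible_def by auto
        then show ?thesis ..
      qed
      then show ?thesis using odd by (metis (full_types) fst_conv snd_conv)
    qed
    then show ?thesis using linked_opposite g h alike by metis
  qed (use linked_alike alike g h \<open>g \<noteq> h\<close> in blast)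
qed (use linked_opposite g h in blast)

text \<open>If \<open>s\<close> and \<open>t\<close> have no pair at a common class, they are joined
  by one or two intermediate terms such that neighbours always have one.\<close>

lemma equivalent_if_leaves_eq:
  assumes "leaves root s = leaves root t"
  shows "s \<approx> t"
  using assms
proof (induction "size (leaves root s)" arbitrary: s t rule: less_induct)
  case less
  note eq = less.prems
  let ?I = "inner root s" and ?m = "leaves root s"
  have below: "unique_below (size ?m)"
    using less.hyps by (auto simp: unique_below_def)
  have I: "inner root t = ?I"
    using balanced_unique balanced_leaves eq by metis
  show ?case
  proof (cases s)
    case (Var x)
    have "inner root t root = 0" using I Var by simp
    then show ?thesis using eq Var by (cases t) auto
  next
    case (Mul s1 s2)
    then have "?I root \<ge> 1" by simp
    then have "inner root t root \<ge> 1" using I by simp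
    then obtain t1 t2 where "t = Mul t1 t2" by (cases t) auto
    then obtain c x y d x' y' where c: "s = plug c (Mul (Var x) (Var y))" and d: "t = plug d (Mul (Var x') (Var y'))"
      using pair_position Mul by metis
    define g h where "g = pos root c" and "h = pos root d"
    have pairs: "has_pair g s" "has_pair h t"
      using c d by (auto simp: has_pair_def g_def h_def)
    note same = equivalent_common_pair[OF below]
    show ?thesis
    proof (cases "g = h")
      case True
      then show ?thesis using same pairs eq by blast
    next
      case False
      have pos: "?I g \<ge> 1" "?I h \<ge> 1"
        using inner_plug[of root c "Mul (Var x) (Var y)" g] inner_plug[of root d "Mul (Var x') (Var y')" h] I
        by (simp_all add: c d g_def h_def)
      \<comment> \<open>Otherwise \<open>s\<close> would be a single product, without an inner node
        of class \<open>h\<close>.\<close>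
      have "c \<noteq> []"
        using pos(2) False by (auto simp: c g_def)
      have "inner root t g \<ge> 1" using pos(1) I by simp
      then have "d \<noteq> []"
        using False by (auto simp: d h_def)
      have "g = root \<longrightarrow> ?I root \<ge> 2" "h = root \<longrightarrow> ?I root \<ge> 2"
        using inner_plug[of root c "Mul (Var x) (Var y)" root] \<open>c \<noteq> []\<close>
          inner_plug[of root d "Mul (Var x') (Var y')" root] \<open>d \<noteq> []\<close> I
        by (auto simp: c d g_def h_def)
      moreover have "num ?m (step True g) \<ge> 1" "num ?m (step False g) \<ge> 1"
        by (simp_all add: c leaves_plug g_def)
      moreover have "num ?m (step True h) \<ge> 1" "num ?m (step False h) \<ge> 1"
        by (simp_all add: eq d leaves_plug h_def)
      ultimately have "contractible ?I ?m g" "contractible ?I ?m h"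
        using pos by (simp_all add: contractible_def)
      then consider "linked ?I ?m g h" | k where "linked ?I ?m g k" "linked ?I ?m k h"
        using linked_exists[OF balanced_leaves \<open>?I root \<ge> 1\<close>] False by blast
      note linked = this
      note linked_term = linked_term[OF balanced_leaves \<open>?I root \<ge> 1\<close>]
      show ?thesis
        using linked
      proof cases
        case 1
        then obtain r where r: "leaves root r = ?m" "has_pair g r" "has_pair h r"
          using linked_term by blast
        then have "s \<approx> r" "r \<approx> t"
          using same pairs eq below equivalent_common_pair[of r h t] by auto
        then show ?thesis by (rule derivable.trans)
      next
        case 2
        then obtain r r' where r: "leaves root r = ?m" "has_pair g r" "has_pair k r"
          and r': "leaves root r' = ?m" "has_pair k r'" "has_pair h r'"
          using linked_term by metis
        have "s \<approx> r" using same pairs(1) r by metis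
        also have "r \<approx> r'" using equivalent_common_pair[of r k r'] below r r' by metis
        also have "r' \<approx> t" using equivalent_common_pair[of r' h t] below pairs(2) eq r' by metis
        finally show ?thesis .
      qed
    qed
  qed
qed

section \<open>Equality of signed counts\<close>

text \<open>For signs \<open>a\<close> and \<open>b\<close>, this is the character of the group of
  classes with value \<open>a\<close> on a left and \<open>b\<close> on a right step.\<close>

fun sgn_class :: "int \<Rightarrow> int \<Rightarrow> parities \<Rightarrow> int" where
  "sgn_class a b (l, r) = (if l then a else 1) * (if r then b else 1)"

lemma sgn_class_step:
  assumes "a * a = 1" "b * b = 1"
  shows "sgn_class a b (step True g) = sgn_class a b g * a"
    and "sgn_class a b (step False g) = sgn_class a b g * b"
  using assms by (cases g; auto simp: ac_simps)+

text \<open>A leaf enters with the product of the coefficients along its path, which depends only on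
  its class. The factor on the left accounts for a term sitting at class \<open>g\<close>.\<close>

lemma eval_linear:
  assumes "a * a = 1" "b * b = 1"
  shows "sgn_class a b g * eval (\<lambda>x y. a * x + b * y) v t = (\<Sum>(x, h)\<in>#leaves g t. sgn_class a b h * v x)"
proof (induction t arbitrary: g)
  case (Mul s t)
  show ?case
    using Mul.IH(1)[of "step True g"] Mul.IH(2)[of "step False g"]
    by (simp add: sgn_class_step[OF assms] algebra_simps)
qed simp

lemma sum_indicator:
  "(\<Sum>(y, h)\<in>#m. sgn_class a b h * (if y = x then 1 else 0)) =
     int (count m (x, root)) + a * int (count m (x, True, False))
       + b * int (count m (x, False, True)) + a * b * int (count m (x, True, True))"
proof (induction m)
  case (add z m)
  obtain y l r where "z = (y, l, r)" by (cases z)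
  then show ?case using add.IH by (cases l; cases r) (auto simp: algebra_simps)
qed simp

definition excess :: "gterm \<Rightarrow> gterm \<Rightarrow> nat \<Rightarrow> parities \<Rightarrow> int" where
  "excess s t x h = int (count (leaves root s) (x, h)) - int (count (leaves root t) (x, h))"

text \<open>These are the multiples of (1, -1, 1, -1), the character with \<open>a = -1\<close> and
  \<open>b = 1\<close>. The three operations give orthogonality to the other three characters, which
  leaves exactly this line.\<close>

definition shifted :: "gterm \<Rightarrow> gterm \<Rightarrow> bool" where
  "shifted s t \<longleftrightarrow> (\<forall>x. excess s t x (True, False) = - excess s t x root \<and>
     excess s t x (False, True) = excess s t x root \<and>
     excess s t x (True, True) = - excess s t x root)"

text \<open>Evaluation at the indicator of \<open>x\<close> isolates the coefficient of
  \<open>x\<close>.\<close>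

lemma signed_counts_eq:
  assumes "a * a = 1" "b * b = 1" "satisfies (\<lambda>x y. a * x + b * y) (s, t)"
  shows "excess s t x root + a * excess s t x (True, False)
    + b * excess s t x (False, True) + a * b * excess s t x (True, True) = 0"
proof -
  let ?v = "\<lambda>y. if y = x then 1 else 0 :: int"
  have "eval (\<lambda>x y. a * x + b * y) ?v s = eval (\<lambda>x y. a * x + b * y) ?v t"
    using assms(3) by (simp add: satisfies_def)
  then show ?thesis
    using eval_linear[OF assms(1,2), of root ?v s] eval_linear[OF assms(1,2), of root ?v t]
    unfolding sum_indicator excess_def by (simp add: algebra_simps)
qed

lemma Sigma124_shifted:
  assumes "(s, t) \<in> Sigma124"
  shows "shifted s t"
  unfolding shifted_def
proof
  fix x
  have "satisfies (\<lambda>x y. 1 * x + 1 * y :: int) (s, t)"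
    "satisfies (\<lambda>x y. 1 * x + (-1) * y :: int) (s, t)"
    "satisfies (\<lambda>x y. (-1) * x + (-1) * y :: int) (s, t)"
    using assms by (simp_all add: Sigma124_def)
  then have
    "excess s t x root + excess s t x (True, False) + excess s t x (False, True) + excess s t x (True, True) = 0"
    "excess s t x root + excess s t x (True, False) - excess s t x (False, True) - excess s t x (True, True) = 0"
    "excess s t x root - excess s t x (True, False) - excess s t x (False, True) + excess s t x (True, True) = 0"
    using signed_counts_eq[of 1 1 s t x] signed_counts_eq[of 1 "-1" s t x] signed_counts_eq[of "-1" "-1" s t x]
    by simp_all
  then show "excess s t x (True, False) = - excess s t x root \<and>
     excess s t x (False, True) = excess s t x root \<and>
     excess s t x (True, True) = - excess s t x root"
    by linarith
qed

section \<open>Shifting two occurrences of a variable by (M7)\<close>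

lemma shift_at_root:
  assumes "balanced I m" "I root \<ge> 1"
  shows "\<exists>u u'. u \<approx> u' \<and>
    leaves root u = add_mset (x, True, False) (add_mset (x, True, True) m) \<and>
    leaves root u' = add_mset (x, root) (add_mset (x, False, True) m)"
proof -
  obtain t where t: "leaves root t = m" using realize assms by blast
  have "inner root t root \<ge> 1"
    using balanced_unique[OF balanced_leaves[of t]] assms t by metis
  then obtain p q where pq: "t = Mul p q" by (cases t) auto
  \<comment> \<open>The product \<open>p q\<close> has class \<open>root\<close> in
    \<open>x (x (p q))\<close>, while \<open>q p\<close> has class \<open>(True, True)\<close> in
    \<open>(x (q p)) x\<close>. The reversed order makes up for this: all leaves of \<open>p\<close>
    and \<open>q\<close> keep their classes.\<close>
  show ?thesis
    using M7[of "Var x" p q] t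
    by (intro exI[of _ "Mul (Var x) (Mul (Var x) (Mul p q))"]
        exI[of _ "Mul (Mul (Var x) (Mul q p)) (Var x)"]) (auto simp: pq)
qed

lemma inner_root_ge_1: "inner root t h \<ge> 1 \<Longrightarrow> inner root t root \<ge> 1"
  by (cases t) auto

text \<open>\<open>(x (q p)) x\<close> has one inner node more than \<open>p q\<close> at each of
  \<open>(True, False)\<close> and \<open>(True, True)\<close>, whence \<open>?J\<close>.\<close>

lemma shift_out:
  assumes eq: "leaves root s = add_mset (x, root) (add_mset (x, False, True) m)"
    and I: "inner root s (True, False) \<ge> 1" "inner root s (True, True) \<ge> 1"
  shows "\<exists>u. s \<approx> u \<and> leaves root u = add_mset (x, True, False) (add_mset (x, True, True) m)"
proof -
  let ?I = "inner root s"
  let ?J = "?I((True, False) := ?I (True, False) - 1, (True, True) := ?I (True, True) - 1)"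
  have "?J root \<ge> 1" using inner_root_ge_1 I by simp
  moreover have "balanced ?J m"
    using balanced_leaves[of s] I unfolding balanced_iff eq by (simp; arith)
  ultimately obtain u u' where "u \<approx> u'"
    "leaves root u = add_mset (x, True, False) (add_mset (x, True, True) m)"
    "leaves root u' = add_mset (x, root) (add_mset (x, False, True) m)"
    using shift_at_root by blast
  then show ?thesis
    using equivalent_if_leaves_eq[of s u'] eq by (metis derivable.sym derivable.trans)
qed

text \<open>\<open>x (x (p q))\<close> has one inner node more than \<open>p q\<close> at each of
  \<open>root\<close> and \<open>(False, True)\<close>, and \<open>p q\<close> itself has one at
  \<open>root\<close>.\<close>

lemma shift_in:
  assumes eq: "leaves root t = add_mset (x, True, False) (add_mset (x, True, True) m)"
    and I: "inner root t root \<ge> 2" "inner root t (False, True) \<ge> 1"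
  shows "\<exists>u. u \<approx> t \<and> leaves root u = add_mset (x, root) (add_mset (x, False, True) m)"
proof -
  let ?I = "inner root t"
  let ?J = "?I(root := ?I root - 1, (False, True) := ?I (False, True) - 1)"
  have "?J root \<ge> 1" using I by simp
  moreover have "balanced ?J m"
    using balanced_leaves[of t] I unfolding balanced_iff eq by (simp; arith)
  ultimately obtain u u' where "u \<approx> u'"
    "leaves root u = add_mset (x, True, False) (add_mset (x, True, True) m)"
    "leaves root u' = add_mset (x, root) (add_mset (x, False, True) m)"
    using shift_at_root by blast
  then show ?thesis
    using equivalent_if_leaves_eq[of u t] eq by (metis derivable.sym derivable.trans)
qed

lemma num_ge_1: "(x, h) \<in># m \<Longrightarrow> num m h \<ge> 1"
proof -
  assume "(x, h) \<in># m"
  then have "h \<in># image_mset snd m" by force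
  then show ?thesis by (simp add: num_def)
qed

lemma num_eq_sum:
  assumes "finite V" "fst ` set_mset m \<subseteq> V"
  shows "num m h = (\<Sum>x\<in>V. count m (x, h))"
  using assms(2)
proof (induction m)
  case (add z m)
  obtain y k where z: "z = (y, k)" by (cases z)
  have "(\<Sum>x\<in>V. count (add_mset z m) (x, h)) = (\<Sum>x\<in>V. count m (x, h) + (if x = y then of_bool (k = h) else 0))"
    by (intro sum.cong) (auto simp: z)
  also have "\<dots> = num m h + of_bool (k = h)"
    using add assms(1) by (simp add: sum.distrib sum.delta z)
  finally show ?case by (simp add: z)
qed simp

text \<open>If all classes occur among the leaves, the identity (M7) applies in one direction or the other.\<close>

lemma shiftable:
  assumes "balanced I m" "\<And>h. num m h \<ge> 1" "\<not> (I (True, False) \<ge> 1 \<and> I (True, True) \<ge> 1)"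
  shows "I root \<ge> 2 \<and> I (False, True) \<ge> 1"
  using assms(1,3) assms(2)[of root] assms(2)[of "(True, False)"] assms(2)[of "(False, True)"]
    assms(2)[of "(True, True)"]
  unfolding balanced_iff by linarith

definition vars :: "gterm \<Rightarrow> nat set" where
  "vars t = fst ` set_mset (leaves root t)"

text \<open>For shifted terms the excess at \<open>root\<close> determines the other three, so this
  class suffices as a measure.\<close>

definition distance :: "nat set \<Rightarrow> gterm \<Rightarrow> gterm \<Rightarrow> nat" where
  "distance V s t = (\<Sum>x\<in>V. nat \<bar>excess s t x root\<bar>)"

text \<open>Covers both moves: shifting out in \<open>s\<close> and shifting in in \<open>t\<close>
  change the excess alike.\<close>

lemma shift_progress:
  assumes "finite V" "x \<in> V" "excess s t x root > 0" "shifted s t"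
    and ex: "\<And>y h. excess s' t' y h = excess s t y h -
      (if y = x then if h = root \<or> h = (False, True) then 1 else - 1 else 0)"
  shows "shifted s' t'" "distance V s' t' < distance V s t"
proof -
  show "shifted s' t'" using assms(4) by (auto simp: shifted_def ex)
  show "distance V s' t' < distance V s t"
    unfolding distance_def using assms(1-3)
    by (intro sum_strict_mono_ex1 bexI[of _ x]) (auto simp: ex)
qed

text \<open>A variable \<open>x\<close> of positive excess is shifted out in \<open>s\<close> if the
  inner nodes needed are there. Otherwise the inner counts of \<open>s\<close> and \<open>t\<close>
  coincide, every class occurs among the leaves, and \<open>shiftable\<close> permits the shift in
  \<open>t\<close>.\<close>

lemma shift_step:
  assumes V: "finite V" "vars s \<subseteq> V" "vars t \<subseteq> V" and sh: "shifted s t"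
    and nonneg: "(\<Sum>x\<in>V. excess s t x root) \<ge> 0" and ne: "y \<in> V" "excess s t y root \<noteq> 0"
  shows "\<exists>s' t'. s \<approx> s' \<and> t' \<approx> t \<and> vars s' \<subseteq> V \<and> vars t' \<subseteq> V \<and> shifted s' t' \<and>
    distance V s' t' < distance V s t"
proof -
  let ?S = "leaves root s" and ?T = "leaves root t"
  let ?A = "(True, False)" and ?B = "(False, True)" and ?C = "(True, True)"
  define K where "K = (\<Sum>x\<in>V. excess s t x root)"
  note sh' = sh[unfolded shifted_def, rule_format]
  have "\<exists>x\<in>V. excess s t x root > 0"
  proof (rule ccontr)
    assume "\<not> (\<exists>x\<in>V. excess s t x root > 0)"
    then have "(\<Sum>x\<in>V. excess s t x root) < (\<Sum>x\<in>V. 0)"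
      using V(1) ne by (intro sum_strict_mono_ex1 bexI[of _ y]) auto
    then show False using nonneg by simp
  qed
  then obtain x where x: "x \<in> V" "excess s t x root > 0" by blast
  have xs: "(x, root) \<in># ?S" "(x, ?B) \<in># ?S" and xt: "(x, ?A) \<in># ?T" "(x, ?C) \<in># ?T"
    using x(2) sh'[of x] unfolding excess_def by (auto simp flip: count_greater_zero_iff)
  obtain m where m: "?S = add_mset (x, root) (add_mset (x, ?B) m)"
    using xs by (metis insert_noteq_member multi_member_split prod.inject)
  obtain n where n: "?T = add_mset (x, ?A) (add_mset (x, ?C) n)"
    using xt by (metis insert_noteq_member multi_member_split prod.inject)
  show ?thesis
  proof (cases "inner root s ?A \<ge> 1 \<and> inner root s ?C \<ge> 1")
    case True
    then obtain u where u: "s \<approx> u" "leaves root u = add_mset (x, ?A) (add_mset (x, ?C) m)"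
      using shift_out m by blast
    have "excess u t z h = excess s t z h - (if z = x then if h = root \<or> h = ?B then 1 else - 1 else 0)" for z h
      by (cases h; cases "fst h"; cases "snd h") (auto simp: excess_def u m)
    from shift_progress[OF V(1) x sh this] have "shifted u t" "distance V u t < distance V s t" .
    moreover have "vars u \<subseteq> V" using V(2) by (auto simp: vars_def u m)
    ultimately show ?thesis using u V(3) by blast
  next
    case False
    have num_diff: "int (num ?S h) - int (num ?T h) = (\<Sum>x\<in>V. excess s t x h)" for h
      using num_eq_sum[OF V(1), of ?S h] num_eq_sum[OF V(1), of ?T h] V
      by (simp add: excess_def sum_subtractf vars_def)
    have diffs: "int (num ?S root) - int (num ?T root) = K" "int (num ?S ?A) - int (num ?T ?A) = - K"
      "int (num ?S ?B) - int (num ?T ?B) = K" "int (num ?S ?C) - int (num ?T ?C) = - K"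
      unfolding num_diff K_def using sh' by (simp_all add: sum_negf)
    \<comment> \<open>The leaf counts differ by \<open>K\<close> times (1, -1, 1, -1). The adjacency
      matrix of the 4-cycle annihilates this vector, so \<open>s\<close> has exactly
      \<open>K\<close> inner nodes more than \<open>t\<close> at \<open>?A\<close> and at
      \<open>?C\<close>; \<open>K > 0\<close> would contradict the case assumption.\<close>
    have "K = 0"
    proof (rule ccontr)
      assume "K \<noteq> 0"
      then have "K > 0" using nonneg by (simp add: K_def)
      then show False
        using balanced_leaves[of s, unfolded balanced_iff] balanced_leaves[of t, unfolded balanced_iff]
          diffs False by linarith
    qed
    have "inner root s = inner root t"
    proof -
      have "\<forall>h. num ?S h = num ?T h"
        unfolding all_parities[of "\<lambda>h. num ?S h = num ?T h"] using diffs \<open>K = 0\<close> by simp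
      then have "balanced (inner root s) ?T"
        using balanced_leaves[of s] unfolding balanced_def by metis
      then show ?thesis using balanced_unique balanced_leaves by blast
    qed
    \<comment> \<open>A variable of negative excess supplies leaves of \<open>s\<close> in the two
      classes where \<open>x\<close> is not known to occur.\<close>
    have "\<exists>z\<in>V. excess s t z root < 0"
    proof (rule ccontr)
      assume "\<not> (\<exists>z\<in>V. excess s t z root < 0)"
      then have "(\<Sum>z\<in>V. 0) < (\<Sum>z\<in>V. excess s t z root)"
        using V(1) x by (intro sum_strict_mono_ex1 bexI[of _ x]) auto
      then show False using \<open>K = 0\<close> by (simp add: K_def)
    qed
    then obtain z where "excess s t z root < 0" by blast
    then have "(z, ?A) \<in># ?S" "(z, ?C) \<in># ?S"
      using sh'[of z] unfolding excess_def by (auto simp flip: count_greater_zero_iff)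
    then have "\<forall>h. num ?S h \<ge> 1"
      unfolding all_parities[of "\<lambda>h. num ?S h \<ge> 1"] using xs num_ge_1 by blast
    then have "inner root t root \<ge> 2" "inner root t ?B \<ge> 1"
      using shiftable[OF balanced_leaves[of s]] False \<open>inner root s = inner root t\<close> by auto
    then obtain u where u: "u \<approx> t" "leaves root u = add_mset (x, root) (add_mset (x, ?B) n)"
      using shift_in n by blast
    have "excess s u z h = excess s t z h - (if z = x then if h = root \<or> h = ?B then 1 else - 1 else 0)" for z h
      by (cases h; cases "fst h"; cases "snd h") (auto simp: excess_def u n)
    from shift_progress[OF V(1) x sh this] have "shifted s u" "distance V s u < distance V s t" .
    moreover have "vars u \<subseteq> V" using V(3) by (auto simp: vars_def u n)
    ultimately show ?thesis using u V(2) by blast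
  qed
qed

lemma excess_swap: "excess t s x h = - excess s t x h"
  by (simp add: excess_def)

lemma shifted_sym: "shifted s t \<Longrightarrow> shifted t s"
  by (simp add: shifted_def excess_swap[of t s])

text \<open>Induction on the distance. \<open>shift_step\<close> needs a nonnegative total excess;
  if it is negative, \<open>s\<close> and \<open>t\<close> change roles.\<close>

lemma equivalent_if_shifted_aux:
  assumes "finite V" "vars s \<subseteq> V" "vars t \<subseteq> V" "shifted s t"
  shows "s \<approx> t"
  using assms(2-4)
proof (induction "distance V s t" arbitrary: s t rule: less_induct)
  case less
  note V = assms(1) less.prems(1,2) and sh = less.prems(3)
  show ?case
  proof (cases "\<forall>y\<in>V. excess s t y root = 0")
    case True
    have "excess s t y root = 0" for y
    proof (cases "y \<in> V")
      case False
      then have "(y, root) \<notin># leaves root s" "(y, root) \<notin># leaves root t"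
        using V by (force simp: vars_def)+
      then show ?thesis by (simp add: excess_def not_in_iff)
    qed (use True in blast)
    then have "\<forall>h. excess s t y h = 0" for y
      unfolding all_parities[of "\<lambda>h. excess s t y h = 0"] using sh by (simp add: shifted_def)
    then have "leaves root s = leaves root t"
      by (intro multiset_eqI) (auto simp: excess_def)
    then show ?thesis by (rule equivalent_if_leaves_eq)
  next
    case False
    then obtain y where y: "y \<in> V" "excess s t y root \<noteq> 0" by blast
    show ?thesis
    proof (cases "(\<Sum>x\<in>V. excess s t x root) \<ge> 0")
      case True
      from shift_step[OF V sh this y] obtain s' t' where "s \<approx> s'" "t' \<approx> t" "s' \<approx> t'"
        using less.hyps by blast
      then show ?thesis by (metis derivable.trans)
    next
      case False
      have "shifted t s" using sh by (rule shifted_sym)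
      moreover have "(\<Sum>x\<in>V. excess t s x root) \<ge> 0"
        using False by (simp add: excess_swap[of t s] sum_negf)
      moreover have "excess t s y root \<noteq> 0" using y by (simp add: excess_swap[of t s])
      ultimately obtain t' s' where st: "t \<approx> t'" "s' \<approx> s" "vars s' \<subseteq> V" "vars t' \<subseteq> V" "shifted t' s'"
        "distance V t' s' < distance V t s"
        using shift_step[OF V(1,3,2) _ _ y(1)] by blast
      have "distance V s' t' < distance V s t"
        using st(6) by (simp add: distance_def excess_swap[of t s] excess_swap[of t' s'])
      moreover have "shifted s' t'" using st(5) by (rule shifted_sym)
      ultimately have "s' \<approx> t'" using less.hyps st by blast
      then show ?thesis using st(1,2) by (metis derivable.sym derivable.trans)
    qed
  qed
qed

lemma basis: "consequences B124 = Sigma124"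
proof (intro equalityI subsetI)
  fix e assume "e \<in> Sigma124"
  then show "e \<in> consequences B124"
    using equivalent_if_shifted_aux[of "vars (fst e) \<union> vars (snd e)" "fst e" "snd e"] Sigma124_shifted
    by (cases e) (auto simp: consequences_def vars_def)
next
  fix e assume "e \<in> consequences B124"
  then have e: "derivable B124 (fst e) (snd e)" by (auto simp: consequences_def)
  have "satisfies (\<lambda>x y. x + y :: int) i" "satisfies (\<lambda>x y. x - y :: int) i"
    "satisfies (\<lambda>x y. - x - y :: int) i" if "i \<in> B124" for i
    using that by (auto simp: B124_def satisfies_def)
  moreover have "satisfies f e" if "\<And>i. i \<in> B124 \<Longrightarrow> satisfies f i" for f :: "int \<Rightarrow> int \<Rightarrow> int"
    using derivable_sound[OF e that] by (simp add: satisfies_def)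
  ultimately show "e \<in> Sigma124"
    by (simp add: Sigma124_def)
qed

section \<open>Independence\<close>

lemma not_consequence:
  assumes "\<And>i. i \<in> B \<Longrightarrow> satisfies f i" "\<not> satisfies f e"
  shows "e \<notin> consequences B"
proof
  assume "e \<in> consequences B"
  then have "derivable B (fst e) (snd e)" by (auto simp: consequences_def)
  from derivable_sound[OF this assms(1)] show False
    using assms(2) by (simp add: satisfies_def)
qed

text \<open>For each of (M1)--(M6), a nilpotent groupoid in which only products of the shape of that
  identity can be nonzero. The elements other than the zero \<open>Out False\<close> and the value \<open>Out True\<close>
  record what matters of a partial product. The value is chosen to vanish on the instances of
  (M7).\<close>

datatype elem = Gen bool | Two bool bool | Three bool | Out bool

text \<open>In \<open>(x y)(z t)\<close>, (M1) exchanges \<open>y\<close> and \<open>z\<close>, (M2)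
  exchanges \<open>x\<close> and \<open>t\<close>. The value depends on the first two only; in
  \<open>op2\<close> it depends on the last two only.\<close>

fun op1 :: "elem \<Rightarrow> elem \<Rightarrow> elem" where
  "op1 (Gen x) (Gen y) = Two x y"
| "op1 (Two x y) (Two z t) = Out (y \<and> \<not> z)"
| "op1 _ _ = Out False"

lemma op1_laws:
  "op1 (op1 x y) (op1 z t) = op1 (op1 t y) (op1 z x)"
  "op1 (op1 (op1 x y) z) t = op1 (op1 (op1 x t) z) y"
  "op1 (op1 x (op1 y z)) t = op1 (op1 x (op1 t z)) y"
  "op1 x (op1 (op1 y z) t) = op1 z (op1 (op1 y x) t)"
  "op1 x (op1 y (op1 z t)) = op1 z (op1 y (op1 x t))"
  "op1 x (op1 x (op1 y z)) = op1 (op1 x (op1 z y)) x"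
  by (cases x; cases y; cases z; cases t; auto)+

fun op2 :: "elem \<Rightarrow> elem \<Rightarrow> elem" where
  "op2 (Gen x) (Gen y) = Two x y"
| "op2 (Two x y) (Two z t) = Out (x \<and> \<not> t)"
| "op2 _ _ = Out False"

lemma op2_laws:
  "op2 (op2 x y) (op2 z t) = op2 (op2 x z) (op2 y t)"
  "op2 (op2 (op2 x y) z) t = op2 (op2 (op2 x t) z) y"
  "op2 (op2 x (op2 y z)) t = op2 (op2 x (op2 t z)) y"
  "op2 x (op2 (op2 y z) t) = op2 z (op2 (op2 y x) t)"
  "op2 x (op2 y (op2 z t)) = op2 z (op2 y (op2 x t))"
  "op2 x (op2 x (op2 y z)) = op2 (op2 x (op2 z y)) x"
  by (cases x; cases y; cases z; cases t; auto)+

fun op3 :: "elem \<Rightarrow> elem \<Rightarrow> elem" where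
  "op3 (Gen x) (Gen y) = Two x y"
| "op3 (Two x y) (Gen z) = Three y"
| "op3 (Three y) (Gen t) = Out (y \<and> \<not> t)"
| "op3 _ _ = Out False"

lemma op3_laws:
  "op3 (op3 x y) (op3 z t) = op3 (op3 x z) (op3 y t)"
  "op3 (op3 x y) (op3 z t) = op3 (op3 t y) (op3 z x)"
  "op3 (op3 x (op3 y z)) t = op3 (op3 x (op3 t z)) y"
  "op3 x (op3 (op3 y z) t) = op3 z (op3 (op3 y x) t)"
  "op3 x (op3 y (op3 z t)) = op3 z (op3 y (op3 x t))"
  "op3 x (op3 x (op3 y z)) = op3 (op3 x (op3 z y)) x"
  by (cases x; cases y; cases z; cases t; auto)+

text \<open>(M4) exchanges \<open>y\<close> and \<open>t\<close>. The conjuncts \<open>x\<close> and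
  \<open>not t\<close> clash on the side \<open>(x (z y)) x\<close> of (M7).\<close>

fun op4 :: "elem \<Rightarrow> elem \<Rightarrow> elem" where
  "op4 (Gen y) (Gen z) = Two y z"
| "op4 (Gen x) (Two y z) = Three (x \<and> y)"
| "op4 (Three p) (Gen t) = Out (p \<and> \<not> t)"
| "op4 _ _ = Out False"

lemma op4_laws:
  "op4 (op4 x y) (op4 z t) = op4 (op4 x z) (op4 y t)"
  "op4 (op4 x y) (op4 z t) = op4 (op4 t y) (op4 z x)"
  "op4 (op4 (op4 x y) z) t = op4 (op4 (op4 x t) z) y"
  "op4 x (op4 (op4 y z) t) = op4 z (op4 (op4 y x) t)"
  "op4 x (op4 y (op4 z t)) = op4 z (op4 y (op4 x t))"
  "op4 x (op4 x (op4 y z)) = op4 (op4 x (op4 z y)) x"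
  by (cases x; cases y; cases z; cases t; auto)+

fun op5 :: "elem \<Rightarrow> elem \<Rightarrow> elem" where
  "op5 (Gen y) (Gen z) = Two y z"
| "op5 (Two y z) (Gen t) = Three z"
| "op5 (Gen x) (Three z) = Out (x \<and> \<not> z)"
| "op5 _ _ = Out False"

lemma op5_laws:
  "op5 (op5 x y) (op5 z t) = op5 (op5 x z) (op5 y t)"
  "op5 (op5 x y) (op5 z t) = op5 (op5 t y) (op5 z x)"
  "op5 (op5 (op5 x y) z) t = op5 (op5 (op5 x t) z) y"
  "op5 (op5 x (op5 y z)) t = op5 (op5 x (op5 t z)) y"
  "op5 x (op5 y (op5 z t)) = op5 z (op5 y (op5 x t))"
  "op5 x (op5 x (op5 y z)) = op5 (op5 x (op5 z y)) x"
  by (cases x; cases y; cases z; cases t; auto)+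

text \<open>(M6) exchanges \<open>x\<close> and \<open>z\<close>. The conjuncts \<open>x\<close> and
  \<open>not y\<close> clash on the side \<open>x (x (y z))\<close> of (M7).\<close>

fun op6 :: "elem \<Rightarrow> elem \<Rightarrow> elem" where
  "op6 (Gen z) (Gen t) = Two z t"
| "op6 (Gen y) (Two z t) = Three (\<not> y \<and> \<not> z)"
| "op6 (Gen x) (Three p) = Out (x \<and> p)"
| "op6 _ _ = Out False"

lemma op6_laws:
  "op6 (op6 x y) (op6 z t) = op6 (op6 x z) (op6 y t)"
  "op6 (op6 x y) (op6 z t) = op6 (op6 t y) (op6 z x)"
  "op6 (op6 (op6 x y) z) t = op6 (op6 (op6 x t) z) y"
  "op6 (op6 x (op6 y z)) t = op6 (op6 x (op6 t z)) y"
  "op6 x (op6 (op6 y z) t) = op6 z (op6 (op6 y x) t)"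
  "op6 x (op6 x (op6 y z)) = op6 (op6 x (op6 z y)) x"
  by (cases x; cases y; cases z; cases t; auto)+

lemma M1_not_consequence:
  defines "e \<equiv> (Mul (Mul vx vy) (Mul vz vt), Mul (Mul vx vz) (Mul vy vt))"
  shows "e \<notin> consequences (B124 - {e})"
proof (rule not_consequence)
  show "satisfies op1 i" if "i \<in> B124 - {e}" for i
    using that unfolding B124_def e_def by (auto simp: satisfies_def intro: op1_laws)
  have "eval op1 (\<lambda>n. Gen (n \<le> 1)) (fst e) \<noteq> eval op1 (\<lambda>n. Gen (n \<le> 1)) (snd e)"
    by (simp add: e_def)
  then show "\<not> satisfies op1 e" unfolding satisfies_def by blast
qed

lemma M2_not_consequence:
  defines "e \<equiv> (Mul (Mul vx vy) (Mul vz vt), Mul (Mul vt vy) (Mul vz vx))"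
  shows "e \<notin> consequences (B124 - {e})"
proof (rule not_consequence)
  show "satisfies op2 i" if "i \<in> B124 - {e}" for i
    using that unfolding B124_def e_def by (auto simp: satisfies_def intro: op2_laws)
  have "eval op2 (\<lambda>n. Gen (n \<le> 1)) (fst e) \<noteq> eval op2 (\<lambda>n. Gen (n \<le> 1)) (snd e)"
    by (simp add: e_def)
  then show "\<not> satisfies op2 e" unfolding satisfies_def by blast
qed

lemma M3_not_consequence:
  defines "e \<equiv> (Mul (Mul (Mul vx vy) vz) vt, Mul (Mul (Mul vx vt) vz) vy)"
  shows "e \<notin> consequences (B124 - {e})"
proof (rule not_consequence)
  show "satisfies op3 i" if "i \<in> B124 - {e}" for i
    using that unfolding B124_def e_def by (auto simp: satisfies_def intro: op3_laws)
  have "eval op3 (\<lambda>n. Gen (n \<le> 1)) (fst e) \<noteq> eval op3 (\<lambda>n. Gen (n \<le> 1)) (snd e)"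
    by (simp add: e_def)
  then show "\<not> satisfies op3 e" unfolding satisfies_def by blast
qed

lemma M4_not_consequence:
  defines "e \<equiv> (Mul (Mul vx (Mul vy vz)) vt, Mul (Mul vx (Mul vt vz)) vy)"
  shows "e \<notin> consequences (B124 - {e})"
proof (rule not_consequence)
  show "satisfies op4 i" if "i \<in> B124 - {e}" for i
    using that unfolding B124_def e_def by (auto simp: satisfies_def intro: op4_laws)
  have "eval op4 (\<lambda>n. Gen (n \<le> 1)) (fst e) \<noteq> eval op4 (\<lambda>n. Gen (n \<le> 1)) (snd e)"
    by (simp add: e_def)
  then show "\<not> satisfies op4 e" unfolding satisfies_def by blast
qed

lemma M5_not_consequence:
  defines "e \<equiv> (Mul vx (Mul (Mul vy vz) vt), Mul vz (Mul (Mul vy vx) vt))"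
  shows "e \<notin> consequences (B124 - {e})"
proof (rule not_consequence)
  show "satisfies op5 i" if "i \<in> B124 - {e}" for i
    using that unfolding B124_def e_def by (auto simp: satisfies_def intro: op5_laws)
  have "eval op5 (\<lambda>n. Gen (n \<le> 1)) (fst e) \<noteq> eval op5 (\<lambda>n. Gen (n \<le> 1)) (snd e)"
    by (simp add: e_def)
  then show "\<not> satisfies op5 e" unfolding satisfies_def by blast
qed

lemma M6_not_consequence:
  defines "e \<equiv> (Mul vx (Mul vy (Mul vz vt)), Mul vz (Mul vy (Mul vx vt)))"
  shows "e \<notin> consequences (B124 - {e})"
proof (rule not_consequence)
  show "satisfies op6 i" if "i \<in> B124 - {e}" for i
    using that unfolding B124_def e_def by (auto simp: satisfies_def intro: op6_laws)
  have "eval op6 (\<lambda>n. Gen (n = 0)) (fst e) \<noteq> eval op6 (\<lambda>n. Gen (n = 0)) (snd e)"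
    by (simp add: e_def)
  then show "\<not> satisfies op6 e" unfolding satisfies_def by blast
qed

text \<open>The operation \<open>y - x\<close> is the fourth choice of signs. It satisfies
  (M1)--(M6), which only exchange subterms of equal class, but gives \<open>x\<close> the
  coefficients -2 and 2 on the two sides of (M7).\<close>

lemma M7_not_consequence:
  defines "e \<equiv> (Mul vx (Mul vx (Mul vy vz)), Mul (Mul vx (Mul vz vy)) vx)"
  shows "e \<notin> consequences (B124 - {e})"
proof (rule not_consequence)
  let ?f = "\<lambda>x y. y - x :: int"
  show "satisfies ?f i" if "i \<in> B124 - {e}" for i
    using that unfolding B124_def e_def by (auto simp: satisfies_def)
  have "eval ?f (\<lambda>n. of_bool (n = 0)) (fst e) \<noteq> eval ?f (\<lambda>n. of_bool (n = 0)) (snd e)"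
    by (simp add: e_def)
  then show "\<not> satisfies ?f e" unfolding satisfies_def by blast
qed

theorem theorem6p1:
  shows "is_basis B124 Sigma124 \<and> independent B124"
proof
  show "is_basis B124 Sigma124"
    using basis by (simp add: is_basis_def)
  show "independent B124"
    unfolding independent_def
  proof
    fix e assume "e \<in> B124"
    then show "e \<notin> consequences (B124 - {e})"
      using M1_not_consequence M2_not_consequence M3_not_consequence M4_not_consequence
        M5_not_consequence M6_not_consequence M7_not_consequence
      by (auto simp: B124_def)
  qed
qed

end
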